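(* Let $\mathcal{G}_3$ be the class of all graphs $G$ such that every induced subgraph $H$ of $G$ with $\gamma_r(H)\geq 3$ satisfies $\gamma_{r2}(H)=2\gamma_r(H)$. Then $$\mathcal{G}_3=\mathrm{Free}(\{\bar{K}_3,C_5\}),$$ that is, a graph $G$ belongs to $\mathcal{G}_3$ if and only if $G$ has no induced subgraph isomorphic to $\bar{K}_3$ or to $C_5$.
   Context: All graphs are finite, simple, and undirected. $N_G(u)$ denotes the set of neighbors of $u$ in $G$. $\bar{K}_3$ is the complement of the complete graph of order $3$ (three pairwise non-adjacent vertices), and $C_5$ is the cycle of order $5$. For a set $\mathcal{F}$ of graphs, $\mathrm{Free}(\mathcal{F})$ is the class of graphs having no induced subgraph isomorphic to a member of $\mathcal{F}$. A $2$-rainbow dominating function of a graph $G$ is a function $f:V(G)\to 2^{\{1,2\}}$ (values are subsets of $\{1,2\}$) such that $\bigcup_{v\in N_G(u)}f(v)=\{1,2\}$ for every vertex $u$ of $G$ with $f(u)=\emptyset$. Its weight is $\sum_{u\in V(G)}|f(u)|$. The $2$-rainbow domination number $\gamma_{r2}(G)$ is the minimum weight of a $2$-rainbow dominating function of $G$. A set $D$ of vertices of $G$ is dominating if every vertex in $V(G)\setminus D$ has a neighbor in $D$. For a function $g:V(G)\to\mathbb{R}$ and two distinct vertices $u,v$ of $G$, let $g_{v\to u}:V(G)\to\mathbb{R}$ be the function with $g_{v\to u}(u)=g(u)+1$, $g_{v\to u}(v)=g(v)-1$, and $g_{v\to u}(x)=g(x)$ for $x\in V(G)\setminus\{u,v\}$.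 A weak Roman dominating function of $G$ is a function $g:V(G)\to\{0,1,2\}$ such that every vertex $u$ of $G$ with $g(u)=0$ has a neighbor $v$ with $g(v)\geq 1$ such that the set $\{x\in V(G): g_{v\to u}(x)\geq 1\}$ is dominating. Its weight is $\sum_{u\in V(G)}g(u)$. The weak Roman domination number $\gamma_r(G)$ is the minimum weight of a weak Roman dominating function of $G$. *)

theory Defs
  imports Complex_Main "Graph_Theory.Graph_Theory"
begin

text \<open>
  Finite simple undirected graphs are the symmetric loop-free digraphs without parallel arcs,
  \<^locale>\<open>pair_graph\<close>: an edge \<open>{u, v}\<close> is the pair of arcs \<open>(u, v)\<close>, \<open>(v, u)\<close>.
  The null graph is allowed; both domination numbers are then \<open>0\<close>.
\<close>

definition nbhd :: "'a pair_pre_digraph \<Rightarrow> 'a \<Rightarrow> 'a set" where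
  "nbhd G u = {v. (u, v) \<in> parcs G}"

definition complement_graph :: "'a pair_pre_digraph \<Rightarrow> 'a pair_pre_digraph" where
  "complement_graph G = \<lparr> pverts = pverts G,
     parcs = {(u, v). u \<in> pverts G \<and> v \<in> pverts G \<and> u \<noteq> v \<and> (u, v) \<notin> parcs G} \<rparr>"

definition complete_graph :: "nat \<Rightarrow> nat pair_pre_digraph" where
  "complete_graph n = \<lparr> pverts = {..<n}, parcs = {(u, v). u < n \<and> v < n \<and> u \<noteq> v} \<rparr>"

text \<open>Only meaningful for \<open>n \<ge> 3\<close>.\<close>
definition cycle_graph :: "nat \<Rightarrow> nat pair_pre_digraph" where
  "cycle_graph n = \<lparr> pverts = {..<n},
     parcs = {(u, v). u < n \<and> v < n \<and> (v = Suc u mod n \<or> u = Suc v mod n)} \<rparr>"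

text \<open>
  The functions below are total on the vertex type; only their values on the vertex set matter.
\<close>

definition rainbow2_dominating :: "'a pair_pre_digraph \<Rightarrow> ('a \<Rightarrow> nat set) \<Rightarrow> bool" where
  "rainbow2_dominating G f \<longleftrightarrow>
     (\<forall>u \<in> pverts G. f u \<subseteq> {1, 2}) \<and>
     (\<forall>u \<in> pverts G. f u = {} \<longrightarrow> (\<Union>v \<in> nbhd G u. f v) = {1, 2})"

definition rainbow2_domination_number :: "'a pair_pre_digraph \<Rightarrow> nat" where
  "rainbow2_domination_number G =
     (LEAST w. \<exists>f. rainbow2_dominating G f \<and> w = (\<Sum>u \<in> pverts G. card (f u)))"

definition dominating_set :: "'a pair_pre_digraph \<Rightarrow> 'a set \<Rightarrow> bool" where
  "dominating_set G D \<longleftrightarrow>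
     D \<subseteq> pverts G \<and> (\<forall>u \<in> pverts G - D. \<exists>v \<in> nbhd G u. v \<in> D)"

text \<open>\<open>move g v u\<close> is $g_{v \to u}$ (for distinct \<open>u\<close>, \<open>v\<close>).\<close>
definition move :: "('a \<Rightarrow> real) \<Rightarrow> 'a \<Rightarrow> 'a \<Rightarrow> 'a \<Rightarrow> real" where
  "move g v u = g(u := g u + 1, v := g v - 1)"

definition weak_roman_dominating :: "'a pair_pre_digraph \<Rightarrow> ('a \<Rightarrow> nat) \<Rightarrow> bool" where
  "weak_roman_dominating G g \<longleftrightarrow>
     (\<forall>u \<in> pverts G. g u \<in> {0, 1, 2}) \<and>
     (\<forall>u \<in> pverts G. g u = 0 \<longrightarrow>
        (\<exists>v \<in> nbhd G u. g v \<ge> 1 \<and>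
           dominating_set G {x \<in> pverts G. move (\<lambda>y. real (g y)) v u x \<ge> 1}))"

definition weak_roman_domination_number :: "'a pair_pre_digraph \<Rightarrow> nat" where
  "weak_roman_domination_number G =
     (LEAST w. \<exists>g. weak_roman_dominating G g \<and> w = (\<Sum>u \<in> pverts G. g u))"

text \<open>
  The forbidden graphs may live on a vertex type different from that of the graphs in the class.
\<close>
definition Free :: "'b pair_pre_digraph set \<Rightarrow> 'a pair_pre_digraph set" where
  "Free \<F> = {G. pair_graph G \<and>
     \<not> (\<exists>H :: 'a pair_pre_digraph. \<exists>F \<in> \<F>.
          induced_subgraph (with_proj H) (with_proj G) \<and> digraph_iso (with_proj H) (with_proj F))}"

definition class_G3 :: "'a pair_pre_digraph set" where
  "class_G3 = {G. pair_graph G \<and>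
     (\<forall>H :: 'a pair_pre_digraph. induced_subgraph (with_proj H) (with_proj G) \<longrightarrow>
        weak_roman_domination_number H \<ge> 3 \<longrightarrow>
        rainbow2_domination_number H = 2 * weak_roman_domination_number H)}"

text \<open>The minima defining the two domination numbers are attained.\<close>

lemma rainbow2_domination_number_attained:
  "\<exists>f. rainbow2_dominating G f \<and>
     rainbow2_domination_number G = (\<Sum>u \<in> pverts G. card (f u))"
proof -
  have "rainbow2_dominating G (\<lambda>_. {1, 2})"
    by (simp add: rainbow2_dominating_def)
  then show ?thesis
    using LeastI_ex[of "\<lambda>w. \<exists>f. rainbow2_dominating G f \<and> w = (\<Sum>u \<in> pverts G. card (f u))"]
    unfolding rainbow2_domination_number_def by blast
qed

lemma weak_roman_domination_number_attained:
  "\<exists>g. weak_roman_dominating G g \<and>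
     weak_roman_domination_number G = (\<Sum>u \<in> pverts G. g u)"
proof -
  have "weak_roman_dominating G (\<lambda>_. 1)"
    by (simp add: weak_roman_dominating_def)
  then show ?thesis
    using LeastI_ex[of "\<lambda>w. \<exists>f. weak_roman_dominating G f \<and> w = (\<Sum>u \<in> pverts G. f u)"]
    unfolding weak_roman_domination_number_def by blast
qed

lemma pair_graph_complement_complete_3: "pair_graph (complement_graph (complete_graph 3))"
proof -
  have "parcs (complement_graph (complete_graph 3)) = {}"
    by (auto simp: complement_graph_def complete_graph_def)
  moreover have "finite (pverts (complement_graph (complete_graph 3)))"
    by (simp add: complement_graph_def complete_graph_def)
  ultimately show ?thesis
    by unfold_locales (simp_all add: symmetric_def)
qed

lemma pair_graph_cycle_5: "pair_graph (cycle_graph 5)"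
proof -
  let ?C = "cycle_graph 5"
  have sub: "parcs ?C \<subseteq> pverts ?C \<times> pverts ?C" and fin: "finite (pverts ?C)"
    unfolding cycle_graph_def by auto
  have sym: "sym (parcs ?C)"
    unfolding cycle_graph_def sym_def by simp blast
  have ne: "u \<noteq> Suc u mod 5" if "u < 5" for u :: nat
    using that by presburger
  have loop: "fst e \<noteq> snd e" if "e \<in> parcs ?C" for e
  proof
    assume "fst e = snd e"
    with that have "fst e < 5" "fst e = Suc (fst e) mod 5"
      by (simp_all add: cycle_graph_def case_prod_beta)
    then show False using ne by blast
  qed
  have fin': "finite (parcs ?C)"
    using finite_subset[OF sub] fin by blast
  show ?thesis
  proof
    show "fst e \<in> pverts ?C" "snd e \<in> pverts ?C" if "e \<in> parcs ?C" for e
      using sub that by (auto simp: mem_Times_iff)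
    show "finite (pverts ?C)" by (rule fin)
    show "finite (parcs ?C)" by (rule fin')
    show "fst e \<noteq> snd e" if "e \<in> parcs ?C" for e
      by (rule loop[OF that])
    show "symmetric (with_proj ?C)"
      unfolding symmetric_def with_proj_simps by (rule sym)
  qed
qed

end

theory Submission
  imports Defs
begin

text \<open>
  Both classes consist of the graphs in which every induced subgraph \<open>H\<close> has \<open>\<gamma>\<^sub>r(H) \<le> 2\<close>.

  One inclusion is a matter of counting vertices. Giving every vertex the value \<open>{1}\<close> shows
  \<open>\<gamma>\<^sub>r\<^sub>2(H) \<le> |V(H)|\<close>, so a graph with \<open>\<gamma>\<^sub>r(H) \<ge> 3\<close> and fewer than six vertices violates
  \<open>\<gamma>\<^sub>r\<^sub>2(H) = 2 \<gamma>\<^sub>r(H)\<close>. The complement of \<open>K\<^sub>3\<close> and the cycle \<open>C\<^sub>5\<close> are two such graphs, hence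
  neither of them is an induced subgraph of a member of the class (\<open>class_G3_no_obstruction\<close>).

  For the other inclusion (\<open>number_le_2_of_Free\<close>) let \<open>H\<close> have no three independent vertices and no
  induced \<open>C\<^sub>5\<close>. If \<open>H\<close> is complete, a single vertex of value \<open>2\<close> suffices. Otherwise put weight \<open>1\<close> on
  two non-adjacent vertices \<open>u\<close>, \<open>v\<close>. Any two non-adjacent vertices dominate \<open>H\<close>, since a vertex
  adjacent to neither would complete an independent triple. So a vertex \<open>x\<close> adjacent to exactly
  one of \<open>u\<close>, \<open>v\<close> can be defended: after the move the weight sits on \<open>x\<close> and its non-neighbor.
  If \<open>x\<close> is adjacent to both and neither move works, there are \<open>y\<close> non-adjacent to \<open>x\<close>, \<open>v\<close> and \<open>z\<close>
  non-adjacent to \<open>x\<close>, \<open>u\<close>; the absence of independent triples then forces the edges \<open>uy\<close>, \<open>yz\<close>,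
  \<open>zv\<close>, and \<open>u, y, z, v, x\<close> is an induced \<open>C\<^sub>5\<close>. This is \<open>secure_pair_of_nonadjacent\<close>.

  Both inclusions pass through \<open>secure_pair\<close>, a reformulation of \<open>\<gamma>\<^sub>r \<le> 2\<close> for non-empty graphs
  that mentions only vertices and adjacency. It reduces \<open>\<gamma>\<^sub>r \<ge> 3\<close> for the two forbidden graphs to an
  inspection of pairs of vertices, and it carries over along isomorphisms.
\<close>

section \<open>Graphs of weak Roman domination number at most two\<close>

text \<open>
  A weak Roman dominating function of weight two consists of two tokens, on \<open>a\<close> and on \<open>b\<close>;
  the case \<open>a = b\<close> is a single vertex of value \<open>2\<close>. A token moves along an edge to the unoccupied
  vertex \<open>x\<close>, and the other one stays.
\<close>

definition secure_pair :: "'a pair_pre_digraph \<Rightarrow> 'a \<Rightarrow> 'a \<Rightarrow> bool" where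
  "secure_pair G a b \<longleftrightarrow> a \<in> pverts G \<and> b \<in> pverts G \<and>
     (\<forall>x \<in> pverts G - {a, b}.
        (x, a) \<in> parcs G \<and> dominating_set G {x, b} \<or>
        (x, b) \<in> parcs G \<and> dominating_set G {x, a})"

lemma dominating_set_mono:
  assumes "dominating_set G D" "D \<subseteq> D'" "D' \<subseteq> pverts G"
  shows "dominating_set G D'"
  using assms unfolding dominating_set_def by blast

lemma dominating_set_pair_iff:
  "dominating_set G {p, q} \<longleftrightarrow> p \<in> pverts G \<and> q \<in> pverts G \<and>
     (\<forall>x \<in> pverts G - {p, q}. (x, p) \<in> parcs G \<or> (x, q) \<in> parcs G)"
  by (auto simp: dominating_set_def nbhd_def)

lemma number_le_2_of_secure_pair:
  assumes fin: "finite (pverts G)" and sec: "secure_pair G a b"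
  shows "weak_roman_domination_number G \<le> 2"
proof -
  define g :: "'a \<Rightarrow> nat" where "g = (\<lambda>x. of_bool (x = a) + of_bool (x = b))"
  have ab: "a \<in> pverts G" "b \<in> pverts G"
    using sec by (auto simp: secure_pair_def)
  have moved: "dominating_set G {y \<in> pverts G. move (\<lambda>y. real (g y)) v x y \<ge> 1}"
    if x: "x \<in> pverts G" "x \<notin> {a, b}" and vw: "{v, w} = {a, b}"
      and dom: "dominating_set G {x, w}" for x v w
  proof (rule dominating_set_mono[OF dom])
    show "{x, w} \<subseteq> {y \<in> pverts G. move (\<lambda>y. real (g y)) v x y \<ge> 1}"
      using x vw ab by (auto simp: move_def g_def doubleton_eq_iff)
  qed auto
  have "weak_roman_dominating G g"
    unfolding weak_roman_dominating_def
  proof (intro conjI ballI impI)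
    show "g u \<in> {0, 1, 2}" for u
      by (auto simp: g_def)
  next
    fix x assume x: "x \<in> pverts G" "g x = 0"
    then have ne: "x \<notin> {a, b}"
      by (auto simp: g_def)
    have "(x, a) \<in> parcs G \<and> dominating_set G {x, b} \<or>
        (x, b) \<in> parcs G \<and> dominating_set G {x, a}"
      using sec x ne by (auto simp: secure_pair_def)
    then show "\<exists>v \<in> nbhd G x. g v \<ge> 1 \<and>
        dominating_set G {y \<in> pverts G. move (\<lambda>y. real (g y)) v x y \<ge> 1}"
    proof
      assume "(x, a) \<in> parcs G \<and> dominating_set G {x, b}"
      then show ?thesis
        using moved[of x a b] x ne by (intro bexI[of _ a]) (auto simp: nbhd_def g_def)
    next
      assume "(x, b) \<in> parcs G \<and> dominating_set G {x, a}"
      then show ?thesis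
        using moved[of x b a] x ne
        by (intro bexI[of _ b]) (auto simp: nbhd_def g_def insert_commute)
    qed
  qed
  moreover have "(\<Sum>x\<in>pverts G. g x) = 2"
    using fin ab by (simp add: g_def sum.distrib of_bool_def)
  ultimately show ?thesis
    unfolding weak_roman_domination_number_def
    by (intro Least_le) (metis (no_types))
qed

text \<open>
  This locates the tokens of a given function. The bound is an inequality so that a function of
  weight one is covered as well: its only token is then counted twice.
\<close>

lemma sum_le_2_supported_on_pair:
  fixes g :: "'a \<Rightarrow> nat"
  assumes fin: "finite V" and le: "(\<Sum>x\<in>V. g x) \<le> 2" and c: "c \<in> V" "g c \<ge> 1"
  obtains a b where "a \<in> V" "b \<in> V" "\<And>x. x \<in> V \<Longrightarrow> g x \<le> of_bool (x = a) + of_bool (x = b)"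
proof (cases "\<exists>d\<in>V - {c}. g d \<ge> 1")
  case True
  then obtain d where d: "d \<in> V - {c}" "g d \<ge> 1" by blast
  have split: "(\<Sum>x\<in>V. g x) = g c + (g d + (\<Sum>x\<in>V - {c} - {d}. g x))"
    using fin c(1) d(1) by (simp add: sum.remove)
  show ?thesis
  proof (rule that[of c d])
    fix x assume x: "x \<in> V"
    have "g x \<le> (\<Sum>x\<in>V - {c} - {d}. g x)" if "x \<noteq> c" "x \<noteq> d"
      using that x fin by (intro member_le_sum) auto
    then show "g x \<le> of_bool (x = c) + of_bool (x = d)"
      using le split c d by (auto simp: of_bool_def)
  qed (use c d in auto)
next
  case False
  show ?thesis
  proof (rule that[of c c])
    fix x assume x: "x \<in> V"
    have "g c \<le> 2"
      using member_le_sum[OF c(1) _ fin, of g] le by simp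
    then show "g x \<le> of_bool (x = c) + of_bool (x = c)"
      using bspec[of "V - {c}" "\<lambda>d. \<not> g d \<ge> 1" x] False x
      by (cases "x = c") (auto simp: not_le)
  qed (use c in auto)
qed

text \<open>
  The tokens of an optimal function form a secure pair: the vertices of positive value after a
  move lie in the pair asserted to dominate, and enlarging a dominating set keeps it dominating.
\<close>

lemma secure_pair_of_number_le_2:
  assumes fin: "finite (pverts G)" and wf: "\<And>u v. (u, v) \<in> parcs G \<Longrightarrow> v \<in> pverts G"
    and ne: "pverts G \<noteq> {}" and le: "weak_roman_domination_number G \<le> 2"
  shows "\<exists>a b. secure_pair G a b"
proof -
  obtain g where g: "weak_roman_dominating G g" and sum: "(\<Sum>u \<in> pverts G. g u) \<le> 2"
    using weak_roman_domination_number_attained[of G] le by auto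
  have defended: "\<exists>v \<in> nbhd G u. g v \<ge> 1 \<and>
      dominating_set G {x \<in> pverts G. move (\<lambda>y. real (g y)) v u x \<ge> 1}"
    if "u \<in> pverts G" "g u = 0" for u
    using g that by (auto simp: weak_roman_dominating_def)
  obtain c where "c \<in> pverts G" "g c \<ge> 1"
  proof -
    obtain u where "u \<in> pverts G" using ne by blast
    then show ?thesis
      using defended[of u] that wf by (cases "g u = 0") (auto simp: nbhd_def)
  qed
  then obtain a b where ab: "a \<in> pverts G" "b \<in> pverts G"
    and bound: "\<And>x. x \<in> pverts G \<Longrightarrow> g x \<le> of_bool (x = a) + of_bool (x = b)"
    using sum_le_2_supported_on_pair[OF fin sum] by blast
  have "secure_pair G a b"
    unfolding secure_pair_def
  proof (intro conjI ballI)
    fix x assume x: "x \<in> pverts G - {a, b}"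
    then have gx: "g x = 0"
      using bound[of x] by simp
    then obtain v where v: "(x, v) \<in> parcs G" "g v \<ge> 1"
      and dom: "dominating_set G {y \<in> pverts G. move (\<lambda>y. real (g y)) v x y \<ge> 1}"
      using defended[of x] x by (auto simp: nbhd_def)
    obtain w where w: "w \<in> pverts G" "{v, w} = {a, b}"
      using v wf[OF v(1)] bound[of v] ab by (cases "v = a"; cases "v = b") auto
    have "{y \<in> pverts G. move (\<lambda>y. real (g y)) v x y \<ge> 1} \<subseteq> {x, w}"
    proof
      fix y assume "y \<in> {y \<in> pverts G. move (\<lambda>y. real (g y)) v x y \<ge> 1}"
      then have y: "y \<in> pverts G" "move (\<lambda>y. real (g y)) v x y \<ge> 1" by auto
      show "y \<in> {x, w}"
        using y bound[OF y(1)] w(2)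
        by (auto simp: move_def of_bool_def doubleton_eq_iff split: if_splits)
    qed
    then have "dominating_set G {x, w}"
      by (rule dominating_set_mono[OF dom]) (use x w in auto)
    then show "(x, a) \<in> parcs G \<and> dominating_set G {x, b} \<or>
        (x, b) \<in> parcs G \<and> dominating_set G {x, a}"
      using v w by (auto simp: doubleton_eq_iff)
  qed (use ab in auto)
  then show ?thesis by blast
qed

lemma rainbow2_domination_number_le_card: "rainbow2_domination_number G \<le> card (pverts G)"
proof -
  have "rainbow2_dominating G (\<lambda>_. {1})"
    by (simp add: rainbow2_dominating_def)
  then show ?thesis
    unfolding rainbow2_domination_number_def
    by (intro Least_le exI[of _ "\<lambda>_. {1}"]) simp
qed

section \<open>Induced copies of a graph\<close>

text \<open>
  An isomorphism of multidigraphs maps vertices and arcs separately. Between graphs whose arcs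
  are pairs, the arc map is determined by the vertex map, so a bijection preserving and
  reflecting adjacency is all that remains. It runs from the pattern \<open>F\<close> into \<open>H\<close>, so that vertices
  of \<open>H\<close> are named by those of \<open>F\<close>.
\<close>

lemma digraph_iso_imp_bij:
  assumes "digraph_iso (with_proj H) (with_proj F)"
  obtains \<psi> where "bij_betw \<psi> (pverts F) (pverts H)"
    "\<And>i j. i \<in> pverts F \<Longrightarrow> j \<in> pverts F \<Longrightarrow> (\<psi> i, \<psi> j) \<in> parcs H \<longleftrightarrow> (i, j) \<in> parcs F"
proof -
  obtain h where h: "pre_digraph.digraph_isomorphism (with_proj H) h"
    and F: "with_proj F = app_iso h (with_proj H)"
    using assms by (auto simp: digraph_iso_def)
  let ?\<phi> = "iso_verts h"
  have verts: "pverts F = ?\<phi> ` pverts H"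
    using arg_cong[OF F, of verts] by simp
  have arcs: "parcs F = iso_arcs h ` parcs H"
    using arg_cong[OF F, of arcs] by simp
  have "iso_tail h = fst" "iso_head h = snd"
    using arg_cong[OF F, of tail] arg_cong[OF F, of head] by simp_all
  with h have wf: "wf_digraph (with_proj H)" and inj: "inj_on ?\<phi> (pverts H)"
    and ends: "\<And>e. e \<in> parcs H \<Longrightarrow> iso_arcs h e = (?\<phi> (fst e), ?\<phi> (snd e))"
    by (auto simp: pre_digraph.digraph_isomorphism_def prod_eq_iff)
  have bij: "bij_betw ?\<phi> (pverts H) (pverts F)"
    using inj verts by (simp add: bij_betw_def)
  have adj: "(?\<phi> u, ?\<phi> v) \<in> parcs F \<longleftrightarrow> (u, v) \<in> parcs H"
    if "u \<in> pverts H" "v \<in> pverts H" for u v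
  proof
    assume "(?\<phi> u, ?\<phi> v) \<in> parcs F"
    then obtain e where e: "e \<in> parcs H" "?\<phi> u = ?\<phi> (fst e)" "?\<phi> v = ?\<phi> (snd e)"
      using arcs ends by auto
    moreover have "fst e \<in> pverts H" "snd e \<in> pverts H"
      using wf_digraph.tail_in_verts[OF wf, of e] wf_digraph.head_in_verts[OF wf, of e] e(1)
      by simp_all
    ultimately show "(u, v) \<in> parcs H"
      using inj_onD[OF inj] that by (metis prod.collapse)
  next
    assume "(u, v) \<in> parcs H"
    then show "(?\<phi> u, ?\<phi> v) \<in> parcs F"
      using arcs ends by force
  qed
  let ?\<psi> = "inv_into (pverts H) ?\<phi>"
  show ?thesis
  proof (rule that[of ?\<psi>])
    show bij': "bij_betw ?\<psi> (pverts F) (pverts H)"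
      using bij by (rule bij_betw_inv_into)
    fix i j assume ij: "i \<in> pverts F" "j \<in> pverts F"
    then show "(?\<psi> i, ?\<psi> j) \<in> parcs H \<longleftrightarrow> (i, j) \<in> parcs F"
      using adj[of "?\<psi> i" "?\<psi> j"] bij_betwE[OF bij'] verts by (simp add: f_inv_into_f)
  qed
qed

text \<open>
  The converse for patterns on the vertices \<open>0, \<dots>, n - 1\<close>: listing vertices of \<open>G\<close> with the
  adjacencies of the pattern exhibits an induced copy.
\<close>

lemma induced_copy_from_list:
  assumes wfG: "pair_wf_digraph G" and F: "pair_wf_digraph F" "pverts F = {..<length vs}"
    and vs: "distinct vs" "set vs \<subseteq> pverts G"
    and adj: "\<And>i j. i < length vs \<Longrightarrow> j < length vs \<Longrightarrow>
      (vs ! i, vs ! j) \<in> parcs G \<longleftrightarrow> (i, j) \<in> parcs F"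
  shows "\<exists>H. induced_subgraph (with_proj H) (with_proj G) \<and>
    digraph_iso (with_proj H) (with_proj F)"
proof -
  define H where "H = \<lparr>pverts = set vs, parcs = parcs G \<inter> set vs \<times> set vs\<rparr>"
  define \<phi> where "\<phi> = inv_into {..<length vs} (nth vs)"
  have bij: "bij_betw (nth vs) {..<length vs} (set vs)"
    using vs(1) by (intro bij_betw_nth) auto
  have bij\<phi>: "bij_betw \<phi> (set vs) {..<length vs}"
    unfolding \<phi>_def using bij by (rule bij_betw_inv_into)
  have wfH: "pair_wf_digraph H"
    by unfold_locales (auto simp: H_def)
  have ind: "induced_subgraph (with_proj H) (with_proj G)"
    using wfH wfG vs(2)
    by (auto simp: induced_subgraph_def subgraph_def compatible_def wf_digraph_wp_iff H_def)
  have \<phi>_nth: "\<phi> (vs ! i) = i" if "i < length vs" for i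
    unfolding \<phi>_def using bij that by (simp add: bij_betw_def inv_into_f_f)
  have parcsF: "parcs F = map_prod \<phi> \<phi> ` parcs H"
  proof (intro set_eqI iffI)
    fix e assume e: "e \<in> parcs F"
    obtain i j where ij: "e = (i, j)" by (cases e)
    have lt: "i < length vs" "j < length vs"
      using pair_wf_digraph.wellformed'[OF F(1)] e ij F(2) by auto
    have "(vs ! i, vs ! j) \<in> parcs H"
      using adj[OF lt] e ij lt by (simp add: H_def)
    moreover have "e = map_prod \<phi> \<phi> (vs ! i, vs ! j)"
      using ij lt by (simp add: \<phi>_nth)
    ultimately show "e \<in> map_prod \<phi> \<phi> ` parcs H" by blast
  next
    fix e assume "e \<in> map_prod \<phi> \<phi> ` parcs H"
    then show "e \<in> parcs F"
      using adj by (auto simp: H_def in_set_conv_nth \<phi>_nth)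
  qed
  have inj: "inj_on \<phi> (set vs)"
    using bij\<phi> by (simp add: bij_betw_def)
  have inj2: "inj_on (map_prod \<phi> \<phi>) (parcs H)"
    by (rule inj_on_subset[OF map_prod_inj_on[OF inj inj]]) (auto simp: H_def)
  have "digraph_iso (with_proj H) (with_proj F)"
    unfolding digraph_iso_def
  proof (intro exI conjI)
    let ?h = "\<lparr>iso_verts = \<phi>, iso_arcs = map_prod \<phi> \<phi>, iso_head = snd, iso_tail = fst\<rparr>"
    show "pre_digraph.digraph_isomorphism (with_proj H) ?h"
      using wfH inj inj2
      by (auto simp: pre_digraph.digraph_isomorphism_def wf_digraph_wp_iff H_def)
    show "with_proj F = app_iso ?h (with_proj H)"
      using parcsF F(2) bij\<phi> by (simp add: app_iso_def with_proj_def bij_betw_def H_def)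
  qed
  with ind show ?thesis by blast
qed

lemma pair_graph_induced:
  assumes "pair_graph G" and ind: "induced_subgraph (with_proj H) (with_proj G)"
  shows "pair_graph H"
proof -
  interpret G: pair_graph G by fact
  have "digraph (with_proj H)" "sym_digraph (with_proj H)"
    using G.digraphI_induced[OF ind] G.induced_graph_imp_graph[OF ind] .
  then show ?thesis
    by (intro pair_graphI_graph) (simp add: graph_def pseudo_graph_def digraph_def)
qed

lemma induced_subgraph_pairD:
  assumes ind: "induced_subgraph (with_proj H) (with_proj G)"
  shows "pverts H \<subseteq> pverts G"
    and "u \<in> pverts H \<Longrightarrow> v \<in> pverts H \<Longrightarrow> (u, v) \<in> parcs H \<longleftrightarrow> (u, v) \<in> parcs G"
proof -
  show "pverts H \<subseteq> pverts G"
    using conjunct1[OF ind[unfolded induced_subgraph_def subgraph_def]] by simp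
  have "parcs H = {e \<in> parcs G. fst e \<in> pverts H \<and> snd e \<in> pverts H}"
    using conjunct2[OF ind[unfolded induced_subgraph_def]] unfolding with_proj_simps .
  then show "u \<in> pverts H \<Longrightarrow> v \<in> pverts H \<Longrightarrow> (u, v) \<in> parcs H \<longleftrightarrow> (u, v) \<in> parcs G"
    by simp
qed

lemma FreeD_pair_graph: "G \<in> Free \<F> \<Longrightarrow> pair_graph G"
  by (simp add: Free_def)

lemma FreeD_no_copy:
  assumes "G \<in> Free \<F>" "F \<in> \<F>"
  shows "\<not> (\<exists>H. induced_subgraph (with_proj H) (with_proj G) \<and>
    digraph_iso (with_proj H) (with_proj F))"
  using assms by (simp add: Free_def)

lemma pair_graph_imp_wf:
  assumes "pair_graph G"
  shows "pair_wf_digraph G"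
proof -
  interpret pair_graph G by fact
  show ?thesis by unfold_locales
qed

section \<open>The forbidden graphs have no secure pair\<close>

lemma dominating_set_transfer:
  assumes bij: "bij_betw \<psi> (pverts F) (pverts H)"
    and adj: "\<And>i j. i \<in> pverts F \<Longrightarrow> j \<in> pverts F \<Longrightarrow>
      (\<psi> i, \<psi> j) \<in> parcs H \<longleftrightarrow> (i, j) \<in> parcs F"
    and D: "D \<subseteq> pverts F" and dom: "dominating_set H (\<psi> ` D)"
  shows "dominating_set F D"
  unfolding dominating_set_def
proof (intro conjI ballI D)
  fix i assume i: "i \<in> pverts F - D"
  have inj: "inj_on \<psi> (pverts F)" and onto: "\<psi> ` pverts F = pverts H"
    using bij by (auto simp: bij_betw_def)
  have "\<psi> i \<in> pverts H - \<psi> ` D"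
    using i D onto inj_on_image_mem_iff[OF inj, of i D] by auto
  then have "\<exists>v \<in> nbhd H (\<psi> i). v \<in> \<psi> ` D"
    using dom unfolding dominating_set_def by blast
  then obtain d where "d \<in> D" "(\<psi> i, \<psi> d) \<in> parcs H"
    by (auto simp: nbhd_def)
  then show "\<exists>v\<in>nbhd F i. v \<in> D"
    using adj[of i d] i D by (auto simp: nbhd_def)
qed

lemma secure_pair_transfer:
  assumes bij: "bij_betw \<psi> (pverts F) (pverts H)"
    and adj: "\<And>i j. i \<in> pverts F \<Longrightarrow> j \<in> pverts F \<Longrightarrow>
      (\<psi> i, \<psi> j) \<in> parcs H \<longleftrightarrow> (i, j) \<in> parcs F"
    and sec: "secure_pair H a b"
  shows "\<exists>i j. secure_pair F i j"
proof -
  have inj: "inj_on \<psi> (pverts F)" and onto: "\<psi> ` pverts F = pverts H"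
    using bij by (auto simp: bij_betw_def)
  obtain i j where ij: "i \<in> pverts F" "j \<in> pverts F" "a = \<psi> i" "b = \<psi> j"
    using sec onto unfolding secure_pair_def by blast
  have "secure_pair F i j"
    unfolding secure_pair_def
  proof (intro conjI ballI ij)
    fix k assume k: "k \<in> pverts F - {i, j}"
    then have "\<psi> k \<in> pverts H - {a, b}"
      using ij inj onto by (auto dest: inj_onD)
    then have "(\<psi> k, \<psi> i) \<in> parcs H \<and> dominating_set H (\<psi> ` {k, j}) \<or>
        (\<psi> k, \<psi> j) \<in> parcs H \<and> dominating_set H (\<psi> ` {k, i})"
      using sec ij by (auto simp: secure_pair_def)
    then show "(k, i) \<in> parcs F \<and> dominating_set F {k, j} \<or>
        (k, j) \<in> parcs F \<and> dominating_set F {k, i}"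
      using dominating_set_transfer[OF bij adj, of "{k, j}"]
        dominating_set_transfer[OF bij adj, of "{k, i}"] adj ij k by auto
  qed
  then show ?thesis by blast
qed

lemma no_secure_pair_independent_3:
  "\<not> secure_pair (complement_graph (complete_graph 3)) a b"
proof
  assume sec: "secure_pair (complement_graph (complete_graph 3)) a b"
  have "{..<3} - {a, b} \<noteq> {}"
  proof
    assume "{..<3} - {a, b} = {}"
    then have "card {..<3::nat} \<le> card {a, b}"
      by (intro card_mono) auto
    also have "\<dots> \<le> 2" by (simp add: card_insert_if)
    finally show False by simp
  qed
  with sec show False
    by (auto simp: secure_pair_def complement_graph_def complete_graph_def)
qed

lemma parcs_cycle_5:
  "parcs (cycle_graph 5) =
     {(0, 1), (1, 2), (2, 3), (3, 4), (4, 0), (1, 0), (2, 1), (3, 2), (4, 3), (0, 4)}"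
  (is "_ = ?E")
proof (intro set_eqI iffI)
  fix e assume e: "e \<in> parcs (cycle_graph 5)"
  obtain u v where uv: "e = (u, v)" by (cases e)
  then have "u < 5" "v < 5"
    using e by (simp_all add: cycle_graph_def)
  then have "u \<in> {0, 1, 2, 3, 4}" "v \<in> {0, 1, 2, 3, 4}"
    by auto
  then show "e \<in> ?E"
    using e unfolding uv cycle_graph_def by (elim insertE emptyE) simp_all
next
  fix e assume "e \<in> ?E"
  then show "e \<in> parcs (cycle_graph 5)"
    unfolding cycle_graph_def by (elim insertE emptyE) simp_all
qed

lemma all_less_5: "(\<forall>i<5. P i) \<longleftrightarrow> P 0 \<and> P 1 \<and> P 2 \<and> P 3 \<and> P (4 :: nat)"
  by (auto simp: eval_nat_numeral All_less_Suc)

text \<open>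
  Two adjacent vertices of \<open>C\<^sub>5\<close> do not dominate it: the vertex opposite to their edge is missed.
  Hence a vertex \<open>x\<close> adjacent to both \<open>a\<close> and \<open>b\<close> cannot be defended, because either move leaves
  tokens on adjacent vertices; and a vertex adjacent to neither is out of reach. It therefore
  suffices to find \<open>x\<close> outside \<open>{a, b}\<close> that does not distinguish \<open>a\<close> from \<open>b\<close>.
\<close>

lemma no_secure_pair_cycle_5: "\<not> secure_pair (cycle_graph 5) a b"
proof
  let ?C = "cycle_graph 5"
  assume sec: "secure_pair ?C a b"
  have verts: "pverts ?C = {0, 1, 2, 3, 4}"
    by (auto simp: cycle_graph_def)
  have adjacent_not_dominating: "\<not> dominating_set ?C {p, q}" if "(p, q) \<in> parcs ?C" for p q
    using that unfolding dominating_set_pair_iff parcs_cycle_5 verts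
    by (elim insertE emptyE) (clarsimp simp: insert_Diff_if)+
  have ab: "a \<in> {0, 1, 2, 3, 4}" "b \<in> {0, 1, 2, 3, 4}"
    using sec by (simp_all add: secure_pair_def verts)
  have "\<exists>x \<in> pverts ?C - {a, b}. (x, a) \<in> parcs ?C \<longleftrightarrow> (x, b) \<in> parcs ?C"
  proof (cases "a = b")
    case True
    have "Suc a mod 5 \<in> pverts ?C - {a}"
      using ab(1) unfolding verts by (elim insertE emptyE) simp_all
    then show ?thesis
      using True by (intro bexI[of _ "Suc a mod 5"]) simp_all
  next
    case False
    \<comment> \<open>Modulo \<open>5\<close> the inverse of \<open>2\<close> is \<open>3\<close>, so \<open>x\<close> solves \<open>2 x = a + b\<close>: it is the midpoint of
        \<open>a\<close> and \<open>b\<close>, fixed by the reflection that swaps them.\<close>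
    let ?x = "3 * (a + b) mod 5"
    have "?x \<in> pverts ?C - {a, b}"
      using ab False unfolding verts by (elim insertE emptyE) simp_all
    moreover have "(?x, a) \<in> parcs ?C \<longleftrightarrow> (?x, b) \<in> parcs ?C"
      using ab False unfolding parcs_cycle_5 by (elim insertE emptyE) simp_all
    ultimately show ?thesis by (rule bexI[rotated])
  qed
  then show False
    using sec adjacent_not_dominating unfolding secure_pair_def by blast
qed

lemma obstruction_number_ge_3:
  fixes H :: "'a pair_pre_digraph"
  assumes H: "pair_fin_digraph H" and iso: "digraph_iso (with_proj H) (with_proj F)"
    and ne: "pverts F \<noteq> {}" and no_pair: "\<And>i j. \<not> secure_pair F i j"
  shows "weak_roman_domination_number H \<ge> 3" and "card (pverts H) = card (pverts F)"
proof -
  obtain \<psi> where \<psi>: "bij_betw \<psi> (pverts F) (pverts H)"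
    "\<And>i j. i \<in> pverts F \<Longrightarrow> j \<in> pverts F \<Longrightarrow> (\<psi> i, \<psi> j) \<in> parcs H \<longleftrightarrow> (i, j) \<in> parcs F"
    using digraph_iso_imp_bij[OF iso] by blast
  show "card (pverts H) = card (pverts F)"
    using bij_betw_same_card[OF \<psi>(1)] by simp
  interpret pair_fin_digraph H by (rule H)
  have "pverts H \<noteq> {}"
    using \<psi>(1) ne by (auto simp: bij_betw_def)
  moreover have "\<not> secure_pair H a b" for a b
    using secure_pair_transfer[OF \<psi>, of a b] no_pair by blast
  ultimately have "\<not> weak_roman_domination_number H \<le> 2"
    using secure_pair_of_number_le_2[of H, OF pair_finite_verts] in_arcsD2 by blast
  then show "weak_roman_domination_number H \<ge> 3" by simp
qed

section \<open>Secure pairs in graphs without the two obstructions\<close>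

text \<open>
  The heart of the matter: failure of both defences of a common neighbor \<open>x\<close> of \<open>u\<close> and \<open>v\<close>
  produces an induced \<open>C\<^sub>5\<close>.
\<close>

lemma (in pair_graph) secure_pair_of_nonadjacent:
  assumes uv: "u \<in> pverts G" "v \<in> pverts G" "u \<noteq> v" "(u, v) \<notin> parcs G"
    and no_indep: "\<And>x y z. {x, y, z} \<subseteq> pverts G \<Longrightarrow> distinct [x, y, z] \<Longrightarrow>
      (x, y) \<in> parcs G \<or> (y, z) \<in> parcs G \<or> (x, z) \<in> parcs G"
    and no_C5: "\<And>vs. length vs = 5 \<Longrightarrow> distinct vs \<Longrightarrow> set vs \<subseteq> pverts G \<Longrightarrow>
      \<not> (\<forall>i<5. \<forall>j<5. (vs ! i, vs ! j) \<in> parcs G \<longleftrightarrow> (i, j) \<in> parcs (cycle_graph 5))"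
  shows "secure_pair G u v"
proof -
  have sym: "(x, y) \<in> parcs G \<longleftrightarrow> (y, x) \<in> parcs G" for x y
    using arcs_symmetric by blast
  have loop: "(x, x) \<notin> parcs G" for x
    using no_loops' by blast
  have nonadj_dom: "dominating_set G {x, y}"
    if "x \<in> pverts G" "y \<in> pverts G" "x \<noteq> y" "(x, y) \<notin> parcs G" for x y
    using that no_indep[of x y] sym by (auto simp: dominating_set_pair_iff)
  have undominated: "\<exists>y \<in> pverts G. y \<notin> {x, w} \<and> (y, x) \<notin> parcs G \<and> (y, w) \<notin> parcs G"
    if "\<not> dominating_set G {x, w}" "x \<in> pverts G" "w \<in> pverts G" for x w
    using that by (auto simp: dominating_set_pair_iff)
  show ?thesis
    unfolding secure_pair_def
  proof (intro conjI ballI uv(1,2))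
    fix x assume x: "x \<in> pverts G - {u, v}"
    consider "(x, u) \<notin> parcs G" | "(x, v) \<notin> parcs G"
      | "(x, u) \<in> parcs G" "(x, v) \<in> parcs G" by blast
    then show "(x, u) \<in> parcs G \<and> dominating_set G {x, v} \<or>
        (x, v) \<in> parcs G \<and> dominating_set G {x, u}"
    proof cases
      case 1
      then show ?thesis
        using no_indep[of x u v] nonadj_dom[of x u] x uv by auto
    next
      case 2
      then show ?thesis
        using no_indep[of x u v] nonadj_dom[of x v] x uv by auto
    next
      case 3
      show ?thesis
      proof (rule ccontr)
        assume "\<not> ?thesis"
        with 3 have "\<not> dominating_set G {x, v}" "\<not> dominating_set G {x, u}" by auto
        then obtain y z where
          y: "y \<in> pverts G" "y \<notin> {x, v}" "(y, x) \<notin> parcs G" "(y, v) \<notin> parcs G" and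
          z: "z \<in> pverts G" "z \<notin> {x, u}" "(z, x) \<notin> parcs G" "(z, u) \<notin> parcs G"
          using undominated x uv by (metis DiffD1)
        have yu: "y \<noteq> u" and zv: "z \<noteq> v"
          using y z 3 sym by auto
        have yu_adj: "(y, u) \<in> parcs G"
          using no_indep[of y u v] y yu uv by auto
        have zv_adj: "(z, v) \<in> parcs G"
          using no_indep[of z v u] z zv uv sym[of u v] by auto
        have yz: "y \<noteq> z" using yu_adj z by auto
        then have yz_adj: "(y, z) \<in> parcs G"
          using no_indep[of y z x] y z x by auto
        \<comment> \<open>The cyclic order of the pentagon: the path \<open>u, y, z, v\<close> is closed up by \<open>x\<close>.\<close>
        let ?vs = "[u, y, z, v, x]"
        have adj: "(u, y) \<in> parcs G" "(y, u) \<in> parcs G" "(y, z) \<in> parcs G" "(z, y) \<in> parcs G"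
          "(z, v) \<in> parcs G" "(v, z) \<in> parcs G" "(v, x) \<in> parcs G" "(x, v) \<in> parcs G"
          "(x, u) \<in> parcs G" "(u, x) \<in> parcs G"
          using yu_adj zv_adj yz_adj 3 sym by blast+
        have nadj: "(u, z) \<notin> parcs G" "(z, u) \<notin> parcs G" "(u, v) \<notin> parcs G" "(v, u) \<notin> parcs G"
          "(y, v) \<notin> parcs G" "(v, y) \<notin> parcs G" "(y, x) \<notin> parcs G" "(x, y) \<notin> parcs G"
          "(z, x) \<notin> parcs G" "(x, z) \<notin> parcs G"
          using y z uv sym by blast+
        have "\<forall>i<5. \<forall>j<5. (?vs ! i, ?vs ! j) \<in> parcs G \<longleftrightarrow> (i, j) \<in> parcs (cycle_graph 5)"
          using adj nadj loop
          by (simp add: all_less_5 parcs_cycle_5)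
        moreover have "distinct ?vs" "set ?vs \<subseteq> pverts G"
          using x y z uv yu zv yz by auto
        ultimately show False
          using no_C5[of ?vs] by simp
      qed
    qed
  qed
qed

text \<open>
  Induced copies of the forbidden graphs are looked for among vertices of \<open>H\<close>, but exhibited in
  \<open>G\<close>; adjacency is the same in both.
\<close>

lemma number_le_2_of_Free:
  fixes G :: "'a pair_pre_digraph"
  assumes G: "G \<in> Free {complement_graph (complete_graph 3), cycle_graph 5}"
    and ind: "induced_subgraph (with_proj H) (with_proj G)"
  shows "weak_roman_domination_number H \<le> 2"
proof -
  let ?I = "complement_graph (complete_graph 3)"
  have pgG: "pair_graph G"
    using G by (rule FreeD_pair_graph)
  interpret H: pair_graph H
    by (rule pair_graph_induced[OF pgG ind])
  note vH = induced_subgraph_pairD(1)[OF ind] and adj = induced_subgraph_pairD(2)[OF ind]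
  have no_copy: "\<not> (\<forall>i < length vs. \<forall>j < length vs. (vs ! i, vs ! j) \<in> parcs H \<longleftrightarrow> (i, j) \<in> parcs F)"
    if F: "F \<in> {?I, cycle_graph 5}" "pverts F = {..<length vs}"
      and vs: "distinct vs" "set vs \<subseteq> pverts H" for F vs
  proof
    assume *: "\<forall>i < length vs. \<forall>j < length vs. (vs ! i, vs ! j) \<in> parcs H \<longleftrightarrow> (i, j) \<in> parcs F"
    have "(vs ! i, vs ! j) \<in> parcs G \<longleftrightarrow> (i, j) \<in> parcs F"
      if "i < length vs" "j < length vs" for i j
      using * that adj[of "vs ! i" "vs ! j"] vs(2) nth_mem by blast
    moreover have "pair_wf_digraph F"
      using F(1) pair_graph_complement_complete_3 pair_graph_cycle_5 pair_graph_imp_wf by blast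
    moreover have "set vs \<subseteq> pverts G"
      using vs(2) vH by blast
    ultimately have "\<exists>K. induced_subgraph (with_proj K) (with_proj G) \<and>
        digraph_iso (with_proj K) (with_proj F)"
      by (intro induced_copy_from_list[OF pair_graph_imp_wf[OF pgG] _ F(2) vs(1)])
    then show False
      using FreeD_no_copy[OF G F(1)] by simp
  qed
  have no_indep: "(x, y) \<in> parcs H \<or> (y, z) \<in> parcs H \<or> (x, z) \<in> parcs H"
    if "{x, y, z} \<subseteq> pverts H" "distinct [x, y, z]" for x y z
    using no_copy[of ?I "[x, y, z]"] that H.arcs_symmetric H.no_loops'
    by (auto simp: complement_graph_def complete_graph_def eval_nat_numeral All_less_Suc)
  have no_C5: "\<not> (\<forall>i<5. \<forall>j<5. (vs ! i, vs ! j) \<in> parcs H \<longleftrightarrow> (i, j) \<in> parcs (cycle_graph 5))"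
    if "length vs = 5" "distinct vs" "set vs \<subseteq> pverts H" for vs
    using no_copy[of "cycle_graph 5" vs] that by (simp add: cycle_graph_def)
  consider "pverts H = {}"
    | u v where "u \<in> pverts H" "v \<in> pverts H" "u \<noteq> v" "(u, v) \<notin> parcs H"
    | u where "u \<in> pverts H"
        "\<forall>u \<in> pverts H. \<forall>v \<in> pverts H. u \<noteq> v \<longrightarrow> (u, v) \<in> parcs H"
    by blast
  then show ?thesis
  proof cases
    case 1
    then show ?thesis
      using weak_roman_domination_number_attained[of H] by auto
  next
    case 2
    then show ?thesis
      using H.secure_pair_of_nonadjacent[OF 2 no_indep no_C5]
        number_le_2_of_secure_pair[OF H.pair_finite_verts] by blast
  next
    case 3
    then have "secure_pair H u u"
      by (simp add: secure_pair_def dominating_set_pair_iff)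
    then show ?thesis
      by (rule number_le_2_of_secure_pair[OF H.pair_finite_verts])
  qed
qed

section \<open>The two classes coincide\<close>

text \<open>
  The equality required of \<open>H\<close> would force at least six vertices, as
  \<open>6 \<le> 2 \<gamma>\<^sub>r(H) = \<gamma>\<^sub>r\<^sub>2(H) \<le> |V(H)|\<close>.
\<close>

lemma class_G3_no_obstruction:
  assumes G: "G \<in> class_G3" and ind: "induced_subgraph (with_proj H) (with_proj G)"
    and F: "pverts F \<noteq> {}" "card (pverts F) < 6" "\<And>i j. \<not> secure_pair F i j"
  shows "\<not> digraph_iso (with_proj H) (with_proj F)"
proof
  assume iso: "digraph_iso (with_proj H) (with_proj F)"
  have "pair_graph G"
    using G by (simp add: class_G3_def)
  then interpret H: pair_graph H
    using ind by (rule pair_graph_induced)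
  note H = obstruction_number_ge_3[OF H.pair_fin_digraph iso F(1,3)]
  have "rainbow2_domination_number H = 2 * weak_roman_domination_number H"
    using G ind H(1) by (simp add: class_G3_def)
  then show False
    using rainbow2_domination_number_le_card[of H] H F(2) by simp
qed

theorem theorem5:
  shows "(class_G3 :: 'a pair_pre_digraph set)
    = Free {complement_graph (complete_graph 3), cycle_graph 5}"
proof (intro set_eqI iffI)
  fix G :: "'a pair_pre_digraph"
  assume G: "G \<in> class_G3"
  have "\<not> digraph_iso (with_proj H) (with_proj F)"
    if ind: "induced_subgraph (with_proj H) (with_proj G)"
      and F: "F \<in> {complement_graph (complete_graph 3), cycle_graph 5}" for H F
  proof (rule class_G3_no_obstruction[OF G ind])
    have "pverts F = {..<3} \<or> pverts F = {..<5}"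
      using F by (auto simp: complement_graph_def complete_graph_def cycle_graph_def)
    then show "pverts F \<noteq> {}" "card (pverts F) < 6"
      by (elim disjE; simp add: lessThan_empty_iff)+
    show "\<not> secure_pair F i j" for i j
      using F no_secure_pair_independent_3 no_secure_pair_cycle_5 by blast
  qed
  then show "G \<in> Free {complement_graph (complete_graph 3), cycle_graph 5}"
    using G by (simp add: Free_def class_G3_def)
next
  fix G :: "'a pair_pre_digraph"
  assume G: "G \<in> Free {complement_graph (complete_graph 3), cycle_graph 5}"
  have "\<not> weak_roman_domination_number H \<ge> 3"
    if "induced_subgraph (with_proj H) (with_proj G)" for H
    using number_le_2_of_Free[OF G that] by simp
  then show "G \<in> class_G3"
    using FreeD_pair_graph[OF G] by (simp add: class_G3_def)
qed

end
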